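(* Let $T$ be an $n\times n$ stochastic matrix partitioned (after a simultaneous permutation of rows and columns) into blocks as $T=[T_{kl}]_{k,l=1}^m$, where the diagonal blocks $T_{kk}$ are square, of order $n_k\ge 1$, and suppose that for some $\delta\in(0,1)$ we have $\omega_{\mathbf 1}(T;k,k)\ge 1-\delta$ for $k=1,\dots,m$. Then we can write $T=B+E$, where $B=B_1\oplus\dots\oplus B_m$ is a direct sum of stochastic matrices with $B_k$ of order $n_k$, and 1. $\|E\|_\infty\le 2\cdot\min\{1,\delta n\}$; 2. $\|E\|_{\mathrm F}\le\min\{2\delta n,\ \sqrt{\delta^2n^2+\delta m},\ \sqrt{\delta n+\delta m}\}$.
   Context: All matrices are real. A square matrix is stochastic if its entries are nonnegative and each row sums to $1$. $\mathbf 1$ is the all-ones vector of the appropriate dimension. For a block matrix, $\omega_{\mathbf 1}(T;k,l):=\dfrac{\mathbf 1^\top T_{kl}\mathbf 1}{n_k}$ is the average row sum of the block $T_{kl}$. The direct sum $B_1\oplus\dots\oplus B_m$ is the block diagonal matrix $\mathrm{diag}(B_1,\dots,B_m)$. $\|\cdot\|_\infty$ is the matrix norm induced by the $\ell_\infty$ vector norm (maximum absolute row sum); $\|\cdot\|_{\mathrm F}$ is the Frobenius norm. *)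

theory Defs
  imports Complex_Main "HOL-Combinatorics.Permutations" "Jordan_Normal_Form.Matrix"
begin

definition stochastic_mat :: "real mat \<Rightarrow> bool" where
  "stochastic_mat A \<longleftrightarrow> square_mat A \<and>
     (\<forall>i<dim_row A. \<forall>j<dim_col A. 0 \<le> A $$ (i, j)) \<and>
     (\<forall>i<dim_row A. (\<Sum>j<dim_col A. A $$ (i, j)) = 1)"

definition perm_rows_cols :: "(nat \<Rightarrow> nat) \<Rightarrow> 'a mat \<Rightarrow> 'a mat" where
  "perm_rows_cols \<sigma> A = mat (dim_row A) (dim_col A) (\<lambda>(i, j). A $$ (\<sigma> i, \<sigma> j))"

text \<open>Blocks are numbered from 0. For block orders \<open>d 0, d 1, \<dots>\<close>, block \<open>k\<close> occupies the
  consecutive indices \<open>block_start d k, \<dots>, block_start d k + d k - 1\<close>.\<close>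

definition block_start :: "(nat \<Rightarrow> nat) \<Rightarrow> nat \<Rightarrow> nat" where
  "block_start d k = (\<Sum>l<k. d l)"

definition block :: "(nat \<Rightarrow> nat) \<Rightarrow> 'a mat \<Rightarrow> nat \<Rightarrow> nat \<Rightarrow> 'a mat" where
  "block d A k l =
     mat (d k) (d l) (\<lambda>(i, j). A $$ (block_start d k + i, block_start d l + j))"

definition ones_vec :: "nat \<Rightarrow> real vec" where
  "ones_vec n = vec n (\<lambda>_. 1)"

definition omega_one :: "(nat \<Rightarrow> nat) \<Rightarrow> real mat \<Rightarrow> nat \<Rightarrow> nat \<Rightarrow> real" where
  "omega_one d A k l =
     (ones_vec (d k) \<bullet> (block d A k l *\<^sub>v ones_vec (d l))) / real (d k)"

text \<open>The inserted 0 matters only for the vector of dimension 0.\<close>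

definition linf_vec_norm :: "real vec \<Rightarrow> real" where
  "linf_vec_norm v = Max (insert 0 {\<bar>v $ i\<bar> | i. i < dim_vec v})"

definition linf_mat_norm :: "real mat \<Rightarrow> real" where
  "linf_mat_norm A =
     Sup {linf_vec_norm (A *\<^sub>v v) | v. v \<in> carrier_vec (dim_col A) \<and> linf_vec_norm v \<le> 1}"

definition frobenius_norm :: "real mat \<Rightarrow> real" where
  "frobenius_norm A = sqrt (\<Sum>i<dim_row A. \<Sum>j<dim_col A. (A $$ (i, j))\<^sup>2)"

lemma linf_vec_norm_le_iff:
  "linf_vec_norm v \<le> c \<longleftrightarrow> 0 \<le> c \<and> (\<forall>i<dim_vec v. \<bar>v $ i\<bar> \<le> c)"
proof -
  have "finite (insert 0 {\<bar>v $ i\<bar> | i. i < dim_vec v})" by simp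
  then show ?thesis unfolding linf_vec_norm_def by (subst Max_le_iff) auto
qed

lemma linf_mat_norm_eq_max_row_sum:
  "linf_mat_norm A =
     Max (insert 0 {(\<Sum>j<dim_col A. \<bar>A $$ (i, j)\<bar>) | i. i < dim_row A})" (is "_ = Max ?R")
proof -
  let ?S = "{linf_vec_norm (A *\<^sub>v v) | v. v \<in> carrier_vec (dim_col A) \<and> linf_vec_norm v \<le> 1}"
  have fin: "finite ?R" by simp
  have entry: "(A *\<^sub>v v) $ i = (\<Sum>j<dim_col A. A $$ (i, j) * v $ j)"
    if "i < dim_row A" "v \<in> carrier_vec (dim_col A)" for i v
    using that by (auto simp: scalar_prod_def lessThan_atLeast0 intro!: sum.cong)
  have upper: "linf_vec_norm (A *\<^sub>v v) \<le> Max ?R"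
    if v: "v \<in> carrier_vec (dim_col A)" "linf_vec_norm v \<le> 1" for v
    unfolding linf_vec_norm_le_iff
  proof (intro conjI allI impI)
    show "0 \<le> Max ?R" using fin by (intro Max_ge) auto
    fix i assume "i < dim_vec (A *\<^sub>v v)"
    then have i: "i < dim_row A" by simp
    have "\<bar>(A *\<^sub>v v) $ i\<bar> \<le> (\<Sum>j<dim_col A. \<bar>A $$ (i, j) * v $ j\<bar>)"
      unfolding entry[OF i v(1)] by (rule sum_abs)
    also have "\<dots> \<le> (\<Sum>j<dim_col A. \<bar>A $$ (i, j)\<bar>)"
      using v by (intro sum_mono) (auto simp: abs_mult linf_vec_norm_le_iff intro!: mult_left_le)
    also have "\<dots> \<le> Max ?R" using fin i by (intro Max_ge) auto
    finally show "\<bar>(A *\<^sub>v v) $ i\<bar> \<le> Max ?R" .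
  qed
  have bdd: "bdd_above ?S" using upper by (auto intro!: bdd_aboveI[of _ "Max ?R"])
  have zero: "linf_vec_norm (A *\<^sub>v 0\<^sub>v (dim_col A)) \<in> ?S"
    by (auto intro!: exI[of _ "0\<^sub>v (dim_col A)"] simp: linf_vec_norm_le_iff)
  have nonneg: "0 \<le> linf_vec_norm w" for w
    using linf_vec_norm_le_iff[of w "linf_vec_norm w"] by simp
  show ?thesis
  proof (rule antisym)
    show "linf_mat_norm A \<le> Max ?R"
      unfolding linf_mat_norm_def using zero upper by (intro cSup_least) auto
    have "r \<le> Sup ?S" if r: "r \<in> ?R" for r
    proof (cases "r = 0")
      case True
      then show ?thesis using cSup_upper[OF zero bdd] nonneg order_trans by blast
    next
      case False
      then obtain i where i: "i < dim_row A" and ri: "r = (\<Sum>j<dim_col A. \<bar>A $$ (i, j)\<bar>)"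
        using r by auto
      define v where "v = vec (dim_col A) (\<lambda>j. sgn (A $$ (i, j)))"
      have v: "v \<in> carrier_vec (dim_col A)" "linf_vec_norm v \<le> 1"
        by (auto simp: v_def linf_vec_norm_le_iff sgn_if)
      have "(A *\<^sub>v v) $ i = r"
        unfolding entry[OF i v(1)] ri by (intro sum.cong) (auto simp: v_def abs_sgn)
      then have "r \<le> linf_vec_norm (A *\<^sub>v v)"
        using linf_vec_norm_le_iff[of "A *\<^sub>v v" "linf_vec_norm (A *\<^sub>v v)"] i by force
      also have "\<dots> \<le> Sup ?S" using v by (intro cSup_upper[OF _ bdd]) auto
      finally show ?thesis .
    qed
    then show "Max ?R \<le> linf_mat_norm A"
      unfolding linf_mat_norm_def using fin by (subst Max_le_iff) auto
  qed
qed

end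

theory Submission
  imports Defs
begin

text \<open>Let \<open>r\<^sub>i\<close> be the mass of row \<open>i\<close> lying outside its diagonal block. Delete the off-diagonal
  blocks and spread \<open>r\<^sub>i\<close> uniformly over the \<open>n\<^sub>k\<close> entries of row \<open>i\<close> in its diagonal block. Then
  row \<open>i\<close> of \<open>E\<close> has absolute sum \<open>2 r\<^sub>i\<close>, and the hypothesis says that the \<open>r\<^sub>i\<close> in block \<open>k\<close> add up to
  at most \<open>\<delta> n\<^sub>k\<close>. The squares of the added entries sum in row \<open>i\<close> to
  \<open>r\<^sub>i\<^sup>2 / n\<^sub>k \<le> r\<^sub>i / n\<^sub>k\<close>, hence to at most \<open>\<delta>\<close> per block; those of the deleted entries, which
  lie in \<open>[0, 1]\<close>, sum to at most both their total \<open>\<Sum>\<^sub>i r\<^sub>i \<le> \<delta> n\<close> and its square.\<close>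

section \<open>Indexing by block number and offset\<close>

definition block_indices :: "(nat \<Rightarrow> nat) \<Rightarrow> nat \<Rightarrow> (nat \<times> nat) set" where
  "block_indices d m = (SIGMA k:{..<m}. {..<d k})"

definition block_index :: "(nat \<Rightarrow> nat) \<Rightarrow> nat \<times> nat \<Rightarrow> nat" where
  "block_index d x = block_start d (fst x) + snd x"

lemma finite_block_indices [simp]: "finite (block_indices d m)"
  unfolding block_indices_def by auto

lemma block_start_Suc: "block_start d (Suc k) = block_start d k + d k"
  unfolding block_start_def by simp

text \<open>Entries can thus be addressed by pairs, for which lying in the same block is equality of
  first components. Induction on the number of blocks works because the last block fills the
  interval right after all earlier ones.\<close>

lemma bij_betw_block_index:
  "bij_betw (block_index d) (block_indices d m) {..<block_start d m}"
proof (induction m)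
  case 0
  then show ?case by (simp add: block_indices_def block_start_def bij_betw_def)
next
  case (Suc m)
  have "bij_betw (block_index d) ({m} \<times> {..<d m}) {block_start d m..<block_start d (Suc m)}"
    by (rule bij_betw_byWitness[where f' = "\<lambda>i. (m, i - block_start d m)"])
      (auto simp: block_index_def block_start_Suc)
  with Suc have "bij_betw (block_index d) (block_indices d m \<union> {m} \<times> {..<d m})
      ({..<block_start d m} \<union> {block_start d m..<block_start d (Suc m)})"
    by (rule bij_betw_combine) auto
  moreover have "block_indices d (Suc m) = block_indices d m \<union> {m} \<times> {..<d m}"
    by (auto simp: block_indices_def less_Suc_eq)
  moreover have "{..<block_start d (Suc m)} =
      {..<block_start d m} \<union> {block_start d m..<block_start d (Suc m)}"
    by (auto simp: block_start_Suc)
  ultimately show ?case by simp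
qed

lemma block_index_less: "x \<in> block_indices d m \<Longrightarrow> block_index d x < block_start d m"
  using bij_betw_apply[OF bij_betw_block_index] by blast

lemma sum_block_indices:
  "(\<Sum>i<block_start d m. f i) = (\<Sum>x\<in>block_indices d m. f (block_index d x))"
  by (rule sum.reindex_bij_betw[OF bij_betw_block_index, symmetric])

text \<open>Evaluates row sums whose terms vanish off the diagonal block: in the nested sum over
  blocks and offsets, only block \<open>k\<close> survives.\<close>

lemma sum_block_indices_diag:
  fixes f :: "nat \<Rightarrow> 'a :: comm_monoid_add"
  assumes "k < m"
  shows "(\<Sum>x\<in>block_indices d m. if k = fst x then f (snd x) else 0) = (\<Sum>a<d k. f a)"
proof -
  have "(\<Sum>x\<in>block_indices d m. if k = fst x then f (snd x) else 0) =
      (\<Sum>l<m. \<Sum>a<d l. if k = l then f a else 0)"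
    unfolding block_indices_def by (simp add: sum.Sigma split_def)
  also have "\<dots> = (\<Sum>l<m. if k = l then \<Sum>a<d l. f a else 0)"
    by (intro sum.cong) auto
  also have "\<dots> = (\<Sum>a<d k. f a)" using assms by (simp add: sum.delta')
  finally show ?thesis .
qed

section \<open>Entries of a block diagonal matrix\<close>

lemma diag_block_mat_carrier:
  assumes "\<forall>k<m. Bs k \<in> carrier_mat (d k) (d k)"
  shows "diag_block_mat (map Bs [0..<m]) \<in> carrier_mat (block_start d m) (block_start d m)"
  using assms
proof (induction m)
  case 0
  then show ?case by (simp add: block_start_def)
next
  case (Suc m)
  then have "diag_block_mat (map Bs [0..<m]) \<in> carrier_mat (block_start d m) (block_start d m)"
    and "Bs m \<in> carrier_mat (d m) (d m)" by auto
  then show ?case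
    by (simp add: diag_block_mat_last Let_def block_start_Suc)
qed

text \<open>Induction splitting off the last block: the induction hypothesis serves two earlier
  indices, two indices in the last block read off \<open>Bs m\<close>, and the mixed cases fall into
  the zero blocks.\<close>

lemma diag_block_mat_index:
  assumes "\<forall>k<m. Bs k \<in> carrier_mat (d k) (d k)"
    and "x \<in> block_indices d m" and "y \<in> block_indices d m"
  shows "diag_block_mat (map Bs [0..<m]) $$ (block_index d x, block_index d y) =
    (if fst x = fst y then Bs (fst x) $$ (snd x, snd y) else 0)"
  using assms
proof (induction m)
  case 0
  then show ?case by (simp add: block_indices_def)
next
  case (Suc m)
  let ?D = "diag_block_mat (map Bs [0..<m])"
  have D: "?D \<in> carrier_mat (block_start d m) (block_start d m)"
    using Suc.prems(1) by (intro diag_block_mat_carrier) auto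
  have Bm: "Bs m \<in> carrier_mat (d m) (d m)" using Suc.prems(1) by auto
  have old: "z \<in> block_indices d m" "block_index d z < block_start d m"
    if "z \<in> block_indices d (Suc m)" "fst z \<noteq> m" for z
  proof -
    show "z \<in> block_indices d m" using that by (auto simp: block_indices_def)
    then show "block_index d z < block_start d m" by (rule block_index_less)
  qed
  have new: "snd z < d m" "block_index d z = block_start d m + snd z"
    if "z \<in> block_indices d (Suc m)" "fst z = m" for z
    using that by (auto simp: block_indices_def block_index_def)
  have IH: "?D $$ (block_index d x, block_index d y) =
      (if fst x = fst y then Bs (fst x) $$ (snd x, snd y) else 0)"
    if "x \<in> block_indices d m" "y \<in> block_indices d m"
    using Suc.IH Suc.prems(1) that by auto
  show ?case
    using Suc.prems(2,3) carrier_matD[OF D] carrier_matD[OF Bm]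
    by (cases "fst x = m"; cases "fst y = m")
      (simp_all add: diag_block_mat_last Let_def old trans_less_add1[OF old(2)] new IH)
qed

text \<open>Each nonnegative term is at most the total, so one factor of its square can be replaced
  by the total.\<close>

lemma sum_power2_le_power2_sum:
  fixes f :: "'a \<Rightarrow> real"
  assumes "finite A" and "\<And>x. x \<in> A \<Longrightarrow> 0 \<le> f x"
  shows "(\<Sum>x\<in>A. (f x)\<^sup>2) \<le> (\<Sum>x\<in>A. f x)\<^sup>2"
proof -
  have "f x \<le> (\<Sum>x\<in>A. f x)" if "x \<in> A" for x
    using assms that by (intro member_le_sum) auto
  then have "(\<Sum>x\<in>A. (f x)\<^sup>2) \<le> (\<Sum>x\<in>A. f x * (\<Sum>x\<in>A. f x))"
    unfolding power2_eq_square by (intro sum_mono mult_left_mono assms)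
  then show ?thesis by (simp add: sum_distrib_right power2_eq_square)
qed

lemma stochastic_mat_perm_rows_cols:
  assumes "A \<in> carrier_mat n n" and "stochastic_mat A" and "\<sigma> permutes {..<n}"
  shows "stochastic_mat (perm_rows_cols \<sigma> A)"
proof -
  have "(\<Sum>j<n. A $$ (i, \<sigma> j)) = (\<Sum>j<n. A $$ (i, j))" for i
    using sum.permute[OF assms(3), of "\<lambda>j. A $$ (i, j)"] by (simp add: o_def)
  moreover have "\<sigma> i < n" if "i < n" for i
    using permutes_in_image[OF assms(3), of i] that by simp
  ultimately show ?thesis
    using assms(1,2) by (auto simp: stochastic_mat_def perm_rows_cols_def)
qed

lemma omega_one_eq:
  "omega_one d A k l =
    (\<Sum>a<d k. \<Sum>b<d l. A $$ (block_index d (k, a), block_index d (l, b))) / real (d k)"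
  unfolding omega_one_def ones_vec_def block_def block_index_def
  by (simp add: scalar_prod_def lessThan_atLeast0)

theorem theorem2p25:
  fixes T :: "real mat" and n m :: nat and d \<sigma> :: "nat \<Rightarrow> nat" and \<delta> :: real
  assumes "n \<ge> 1"
    and "T \<in> carrier_mat n n"
    and "stochastic_mat T"
    and "\<sigma> permutes {..<n}"
    and "\<forall>k<m. d k \<ge> 1"
    and "(\<Sum>k<m. d k) = n"
    and "0 < \<delta>" and "\<delta> < 1"
    and "\<forall>k<m. omega_one d (perm_rows_cols \<sigma> T) k k \<ge> 1 - \<delta>"
  shows "\<exists>(Bs :: nat \<Rightarrow> real mat) (B :: real mat) (E :: real mat).
           (\<forall>k<m. Bs k \<in> carrier_mat (d k) (d k) \<and> stochastic_mat (Bs k)) \<and>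
           B = diag_block_mat (map Bs [0..<m]) \<and>
           E \<in> carrier_mat n n \<and>
           perm_rows_cols \<sigma> T = B + E \<and>
           linf_mat_norm E \<le> 2 * min 1 (\<delta> * real n) \<and>
           frobenius_norm E \<le>
             Min {2 * \<delta> * real n,
                  sqrt (\<delta>\<^sup>2 * (real n)\<^sup>2 + \<delta> * real m),
                  sqrt (\<delta> * real n + \<delta> * real m)}"
proof -

  \<comment> \<open>Row masses inside and outside the diagonal blocks\<close>
  define P where "P = perm_rows_cols \<sigma> T"
  define I where "I = block_indices d m"
  define p where "p x y = P $$ (block_index d x, block_index d y)" for x y
  \<comment> \<open>Defined as the defect of the row sum inside the diagonal block; as rows of
    \<open>P\<close> sum to 1, \<open>w_sum\<close> identifies it with the mass outside.\<close>
  define r where "r x = 1 - (\<Sum>b<d (fst x). p x (fst x, b))" for x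
  have n: "n = block_start d m" using assms(6) by (simp add: block_start_def)
  have P: "P \<in> carrier_mat n n" using assms(2) by (simp add: P_def perm_rows_cols_def)
  have stP: "stochastic_mat P"
    unfolding P_def using assms(2-4) by (rule stochastic_mat_perm_rows_cols)
  have fin: "finite I" by (simp add: I_def)
  have idx: "block_index d x < n" if "x \<in> I" for x
    using that block_index_less by (auto simp: n I_def)
  have sumI: "(\<Sum>i<n. f i) = (\<Sum>x\<in>I. f (block_index d x))" for f :: "nat \<Rightarrow> real"
    unfolding n I_def by (rule sum_block_indices)
  have p_nonneg: "0 \<le> p x y" if "x \<in> I" "y \<in> I" for x y
    using stP P idx that by (auto simp: stochastic_mat_def p_def)
  have p_sum: "(\<Sum>y\<in>I. p x y) = 1" if "x \<in> I" for x
    using stP P idx[OF that] by (auto simp: stochastic_mat_def p_def sumI)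
  have diag_sum: "(\<Sum>y\<in>I. if fst x = fst y then f (snd y) else 0) = (\<Sum>b<d (fst x). f b)"
    if "x \<in> I" for x and f :: "nat \<Rightarrow> real"
    unfolding I_def by (rule sum_block_indices_diag) (use that in \<open>auto simp: I_def block_indices_def\<close>)

  \<comment> \<open>\<open>w\<close> collects the deleted entries and \<open>u\<close> the added
    ones, so that \<open>E\<close> becomes \<open>w - u\<close>. Their supports are
    disjoint.\<close>
  define w where "w x y = (if fst x = fst y then 0 else p x y)" for x y
  define u where "u x y = (if fst x = fst y then r x / real (d (fst x)) else 0)" for x y :: "nat \<times> nat"
  have w_nonneg: "0 \<le> w x y" if "x \<in> I" "y \<in> I" for x y
    using p_nonneg that by (simp add: w_def)
  have w_sum: "(\<Sum>y\<in>I. w x y) = r x" if x: "x \<in> I" for x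
  proof -
    \<comment> \<open>Within one block \<open>y\<close> equals \<open>(fst x, snd y)\<close>; this
      form lets \<open>diag_sum\<close> apply, whose summand depends on \<open>snd y\<close>
      only.\<close>
    have "p x y = w x y + (if fst x = fst y then p x (fst x, snd y) else 0)" for y
      by (cases y) (auto simp: w_def)
    then have "1 = (\<Sum>y\<in>I. w x y + (if fst x = fst y then p x (fst x, snd y) else 0))"
      using p_sum[OF x] by simp
    then show ?thesis
      using diag_sum[OF x, of "\<lambda>b. p x (fst x, b)"] by (simp add: sum.distrib r_def)
  qed
  have r_nonneg: "0 \<le> r x" if "x \<in> I" for x
    using w_sum[OF that] w_nonneg that by (metis sum_nonneg)
  have d_pos: "0 < d (fst x)" if "x \<in> I" for x
    using that by (auto simp: I_def block_indices_def)
  have r_le_1: "r x \<le> 1" if "x \<in> I" for x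
  proof -
    have "0 \<le> p x (fst x, b)" if "b < d (fst x)" for b
      using that \<open>x \<in> I\<close> by (intro p_nonneg) (auto simp: I_def block_indices_def)
    then have "0 \<le> (\<Sum>b<d (fst x). p x (fst x, b))" by (intro sum_nonneg) simp
    then show ?thesis by (simp add: r_def)
  qed
  have u_nonneg: "0 \<le> u x y" if "x \<in> I" for x y
    using r_nonneg that by (simp add: u_def)
  have u_sum: "(\<Sum>y\<in>I. u x y) = r x" if "x \<in> I" for x
    using diag_sum[OF that, of "\<lambda>_. r x / real (d (fst x))"] d_pos[OF that] by (simp add: u_def)
  have r_block: "(\<Sum>a<d k. r (k, a)) \<le> \<delta> * real (d k)" if "k < m" for k
  proof -
    have "0 < real (d k)" using assms(5) that by force
    moreover have "1 - \<delta> \<le> (\<Sum>a<d k. \<Sum>b<d k. p (k, a) (k, b)) / real (d k)"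
      using assms(9) that by (simp add: omega_one_eq p_def P_def)
    ultimately have "(1 - \<delta>) * real (d k) \<le> (\<Sum>a<d k. \<Sum>b<d k. p (k, a) (k, b))"
      by (simp add: pos_le_divide_eq)
    \<comment> \<open>The defects in block \<open>k\<close> add up to \<open>d k\<close> minus the
      total of its entries.\<close>
    then show ?thesis by (simp add: r_def sum_subtractf algebra_simps)
  qed
  have sum_nested: "(\<Sum>x\<in>I. f x) = (\<Sum>k<m. \<Sum>a<d k. f (k, a))" for f :: "nat \<times> nat \<Rightarrow> real"
    by (simp add: I_def block_indices_def sum.Sigma)
  have r_total: "(\<Sum>x\<in>I. r x) \<le> \<delta> * real n"
  proof -
    have "(\<Sum>x\<in>I. r x) \<le> (\<Sum>k<m. \<delta> * real (d k))"
      unfolding sum_nested by (intro sum_mono r_block) simp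
    also have "\<dots> = \<delta> * real n" by (simp add: assms(6)[symmetric] sum_distrib_left)
    finally show ?thesis .
  qed
  have r_le: "r x \<le> \<delta> * real n" if "x \<in> I" for x
    using member_le_sum[OF that, of r] r_nonneg fin r_total by fastforce

  \<comment> \<open>The stochastic blocks and the remainder\<close>
  define Bs where
    "Bs k = mat (d k) (d k) (\<lambda>(a, b). p (k, a) (k, b) + r (k, a) / real (d k))" for k
  define B where "B = diag_block_mat (map Bs [0..<m])"
  define E where "E = P - B"
  have Bs: "\<forall>k<m. Bs k \<in> carrier_mat (d k) (d k)" by (simp add: Bs_def)
  have B: "B \<in> carrier_mat n n" unfolding B_def n by (rule diag_block_mat_carrier[OF Bs])
  have stBs: "stochastic_mat (Bs k)" if k: "k < m" for k
  proof -
    have mem: "(k, a) \<in> I" if "a < d k" for a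
      using k that by (auto simp: I_def block_indices_def)
    then have "0 \<le> p (k, a) (k, b) + r (k, a) / real (d k)" if "a < d k" "b < d k" for a b
      using that p_nonneg r_nonneg by simp
    \<comment> \<open>The \<open>d k\<close> equal shares of \<open>r (k, a)\<close> restore exactly
      the missing mass.\<close>
    moreover have "(\<Sum>b<d k. p (k, a) (k, b) + r (k, a) / real (d k)) = 1" if "a < d k" for a
      using that by (simp add: sum.distrib r_def)
    ultimately show ?thesis by (auto simp: stochastic_mat_def Bs_def)
  qed
  have E: "E \<in> carrier_mat n n" unfolding E_def using B by (rule minus_carrier_mat)
  have PBE: "P = B + E" using P B by (intro eq_matI) (auto simp: E_def)
  have E_idx: "E $$ (block_index d x, block_index d y) = w x y - u x y"
    if x: "x \<in> I" and y: "y \<in> I" for x y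
  proof -
    have "B $$ (block_index d x, block_index d y) =
        (if fst x = fst y then Bs (fst x) $$ (snd x, snd y) else 0)"
      unfolding B_def using diag_block_mat_index[OF Bs] x y by (simp add: I_def)
    also have "\<dots> = (if fst x = fst y then p x y + r x / real (d (fst x)) else 0)"
      using x y by (cases x; cases y) (auto simp: Bs_def I_def block_indices_def)
    finally show ?thesis
      using B idx[OF x] idx[OF y] by (auto simp: E_def w_def u_def p_def)
  qed

  \<comment> \<open>The maximum absolute row sum\<close>
  have row: "(\<Sum>j<n. \<bar>E $$ (block_index d x, j)\<bar>) = 2 * r x" if x: "x \<in> I" for x
  proof -
    \<comment> \<open>At most one of \<open>w x y\<close> and \<open>u x y\<close> is nonzero, and
      both are nonnegative.\<close>
    have "\<bar>w x y - u x y\<bar> = w x y + u x y" if "y \<in> I" for y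
      using w_nonneg[OF x that] r_nonneg[OF x] by (auto simp: w_def u_def)
    then have "(\<Sum>j<n. \<bar>E $$ (block_index d x, j)\<bar>) = (\<Sum>y\<in>I. w x y + u x y)"
      unfolding sumI using x by (intro sum.cong) (auto simp: E_idx)
    then show ?thesis using w_sum[OF x] u_sum[OF x] by (simp add: sum.distrib)
  qed
  have linf: "linf_mat_norm E \<le> 2 * min 1 (\<delta> * real n)"
    unfolding linf_mat_norm_eq_max_row_sum
  proof (subst Max_le_iff, simp, simp, intro ballI)
    fix s assume "s \<in> insert 0 {\<Sum>j<dim_col E. \<bar>E $$ (i, j)\<bar> |i. i < dim_row E}"
    then consider "s = 0" | i where "i < n" "s = (\<Sum>j<n. \<bar>E $$ (i, j)\<bar>)"
      using E by auto
    then show "s \<le> 2 * min 1 (\<delta> * real n)"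
    proof cases
      case 1
      then show ?thesis using assms(7) by simp
    next
      case 2
      then have "i \<in> block_index d ` I"
        using bij_betw_imp_surj_on[OF bij_betw_block_index, of d m] by (simp add: n I_def)
      then obtain x where "x \<in> I" "i = block_index d x" by blast
      then show ?thesis using 2 row r_le_1 r_le by simp
    qed
  qed

  \<comment> \<open>The Frobenius norm\<close>
  define S where "S = (\<Sum>i<n. \<Sum>j<n. (E $$ (i, j))\<^sup>2)"
  have frob: "frobenius_norm E = sqrt S" using E by (simp add: frobenius_norm_def S_def)
  define W where "W = (\<Sum>x\<in>I. \<Sum>y\<in>I. (w x y)\<^sup>2)"
  have S_eq: "S = W + (\<Sum>x\<in>I. \<Sum>y\<in>I. (u x y)\<^sup>2)"
  proof -
    \<comment> \<open>Disjoint supports make the cross term vanish.\<close>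
    have "(w x y - u x y)\<^sup>2 = (w x y)\<^sup>2 + (u x y)\<^sup>2" for x y by (auto simp: w_def u_def)
    then have "S = (\<Sum>x\<in>I. \<Sum>y\<in>I. (w x y)\<^sup>2 + (u x y)\<^sup>2)"
      unfolding S_def sumI by (intro sum.cong refl) (simp add: E_idx)
    then show ?thesis by (simp add: sum.distrib W_def)
  qed
  have "(\<Sum>x\<in>I. \<Sum>y\<in>I. (u x y)\<^sup>2) \<le> (\<Sum>x\<in>I. r x / real (d (fst x)))"
  proof (rule sum_mono)
    fix x assume x: "x \<in> I"
    \<comment> \<open>Along row \<open>x\<close>, \<open>u\<close> is either 0 or one fixed value,
      so squaring it amounts to multiplying it by that value.\<close>
    have "(\<Sum>y\<in>I. (u x y)\<^sup>2) = (\<Sum>y\<in>I. r x / real (d (fst x)) * u x y)"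
      by (intro sum.cong) (auto simp: u_def power2_eq_square)
    also have "\<dots> = r x / real (d (fst x)) * r x"
      using u_sum[OF x] by (simp only: sum_distrib_left[symmetric])
    also have "\<dots> \<le> r x / real (d (fst x))"
      using r_nonneg[OF x] r_le_1[OF x] by (intro mult_left_le) auto
    finally show "(\<Sum>y\<in>I. (u x y)\<^sup>2) \<le> r x / real (d (fst x))" .
  qed
  \<comment> \<open>The divisor \<open>d k\<close> cancels the factor \<open>d k\<close> in
    \<open>r_block\<close>, leaving one \<delta> per block.\<close>
  also have "\<dots> \<le> (\<Sum>k<m. \<delta>)"
  proof (unfold sum_nested fst_conv, rule sum_mono)
    fix k assume "k \<in> {..<m}"
    then have "0 < real (d k)" and "(\<Sum>a<d k. r (k, a)) \<le> \<delta> * real (d k)"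
      using assms(5) r_block by force+
    then show "(\<Sum>a<d k. r (k, a) / real (d k)) \<le> \<delta>"
      by (simp add: sum_divide_distrib[symmetric] pos_divide_le_eq)
  qed
  finally have S_le: "S \<le> W + \<delta> * real m" using S_eq by (simp add: mult.commute)
  have W_le: "W \<le> (\<delta> * real n)\<^sup>2"
  proof -
    have "W = (\<Sum>z\<in>I \<times> I. (w (fst z) (snd z))\<^sup>2)"
      by (simp add: W_def sum.cartesian_product split_def)
    also have "\<dots> \<le> (\<Sum>z\<in>I \<times> I. w (fst z) (snd z))\<^sup>2"
      using fin w_nonneg by (intro sum_power2_le_power2_sum) auto
    also have "(\<Sum>z\<in>I \<times> I. w (fst z) (snd z)) = (\<Sum>x\<in>I. r x)"
      using w_sum sum.cartesian_product[of w I I] by (simp add: split_def)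
    also have "(\<Sum>x\<in>I. r x)\<^sup>2 \<le> (\<delta> * real n)\<^sup>2"
      using r_total r_nonneg by (intro power_mono sum_nonneg)
    finally show ?thesis .
  qed
  have W_le': "W \<le> \<delta> * real n"
  proof -
    \<comment> \<open>Entries of \<open>w\<close> are at most \<open>r x\<close>, hence at most 1,
      and squaring does not increase them.\<close>
    have "(w x y)\<^sup>2 \<le> w x y" if "x \<in> I" "y \<in> I" for x y
    proof -
      have "w x y \<le> r x"
        using member_le_sum[OF that(2), of "w x"] w_nonneg fin w_sum that by auto
      then show ?thesis
        using r_le_1[OF that(1)] w_nonneg[OF that] unfolding power2_eq_square
        by (intro mult_left_le) auto
    qed
    then have "W \<le> (\<Sum>x\<in>I. \<Sum>y\<in>I. w x y)" unfolding W_def by (intro sum_mono)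
    also have "\<dots> \<le> \<delta> * real n" using w_sum r_total by simp
    finally show ?thesis .
  qed
  have S_le': "S \<le> (2 * \<delta> * real n)\<^sup>2"
  proof -
    \<comment> \<open>The square sum of \<open>E\<close> is at most the square of its total absolute
      mass, which by \<open>row\<close> is twice the sum of all \<open>r x\<close>.\<close>
    have "S = (\<Sum>z\<in>{..<n} \<times> {..<n}. \<bar>E $$ z\<bar>\<^sup>2)"
      by (simp add: S_def sum.cartesian_product)
    also have "\<dots> \<le> (\<Sum>z\<in>{..<n} \<times> {..<n}. \<bar>E $$ z\<bar>)\<^sup>2"
      by (rule sum_power2_le_power2_sum) auto
    also have "(\<Sum>z\<in>{..<n} \<times> {..<n}. \<bar>E $$ z\<bar>) = (\<Sum>i<n. \<Sum>j<n. \<bar>E $$ (i, j)\<bar>)"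
      by (simp add: sum.cartesian_product)
    also have "\<dots> = 2 * (\<Sum>x\<in>I. r x)"
      unfolding sumI[of "\<lambda>i. \<Sum>j<n. \<bar>E $$ (i, j)\<bar>"] using row by (simp add: sum_distrib_left)
    also have "(2 * (\<Sum>x\<in>I. r x))\<^sup>2 \<le> (2 * \<delta> * real n)\<^sup>2"
      using r_total r_nonneg by (intro power_mono) (auto intro: sum_nonneg)
    finally show ?thesis .
  qed
  have "frobenius_norm E \<le> 2 * \<delta> * real n"
    unfolding frob using S_le' assms(7) by (intro real_le_lsqrt) auto
  moreover have "frobenius_norm E \<le> sqrt (\<delta>\<^sup>2 * (real n)\<^sup>2 + \<delta> * real m)"
    unfolding frob using S_le W_le by (simp add: power_mult_distrib)
  moreover have "frobenius_norm E \<le> sqrt (\<delta> * real n + \<delta> * real m)"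
    unfolding frob using S_le W_le' by simp
  ultimately have "frobenius_norm E \<le> Min {2 * \<delta> * real n,
      sqrt (\<delta>\<^sup>2 * (real n)\<^sup>2 + \<delta> * real m), sqrt (\<delta> * real n + \<delta> * real m)}"
    by simp
  then show ?thesis
    using Bs stBs B_def E PBE linf unfolding P_def by blast
qed

end
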